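(* Let $A$ be a finite cyclic group, let $B$ be a group, let $K\subset B$ be a subset, and let $G=A\wr B$ be the wreath product. Then the Schreier digraph of the right action of $G$ on the homogeneous space $A\backslash G\cong B^{|A|}$, given in terms of $B^{|A|}$ by $$ \boldsymbol b.(a,\Phi)=\mathbf T^{-a}(\boldsymbol b\cdot\Phi),\qquad \boldsymbol b\in B^{|A|},\ (a,\Phi)\in G, $$ with respect to the set $\widetilde K_+=\{(1,\delta_1^b)\}_{b\in K}\subset G$, is isomorphic to the Cayley circular slider digraph $\overrightarrow{\mathscr S}_K\left(B^{|A|}\right)$.
   Context: The group $A\cong\mathbb Z_n$, $n=|A|$, is written additively, with distinguished generator $1$. $B$ is a group with identity $e$, written multiplicatively. Let $\mathrm{fun}(A,B)$ be the group of all functions (configurations) $\Phi:A\to B$ with pointwise multiplication (as $A$ is finite, every configuration is finitely supported). The group $A$ acts on it by automorphisms $(\mathbf T^a\Phi)(x)=\Phi(x-a)$. The wreath product $G=A\wr B$ is the set $A\times\mathrm{fun}(A,B)$ with multiplication $$(a_1,\Phi_1)\cdot(a_2,\Phi_2)=(a_1+a_2,\ \Phi_1\cdot\mathbf T^{a_1}\Phi_2).$$ For $a\in A$, $b\in B$ the configuration $\delta_a^b$ takes the value $b$ at $a$ and $e$ elsewhere. Let $\varnothing$ be the configuration identically equal to $e$. The group $A$ is embedded in $G$ as the subgroup $\{(a,\varnothing):a\in A\}$. The space of cosets $A\backslash G=\{Ag: g\in G\}$ is identified with $\mathrm{fun}(A,B)$ by the map induced by $(a,\Phi)\mapsto\mathbf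 T^{-a}\Phi$. Further, $\mathrm{fun}(A,B)$ is identified with $B^n$ by associating with a configuration $\Psi$ the word $\beta_1\beta_2\dots\beta_n$, $\beta_i=\Psi(i \bmod n)$. Under these identifications the natural right action of $G$ on $A\backslash G$ takes the form displayed in the claim. Given a right action of a group $G$ on a set $X$ and a subset $S\subset G$, the Schreier digraph has vertex set $X$ and arrows $x\to xs$, $x\in X$, $s\in S$. For a group $B$, a subset $K\subset B$ and $n\ge1$, the Cayley circular slider digraph $\overrightarrow{\mathscr S}_K(B^n)$ has vertex set $B^n$ and arrows $$(g_1,g_2,\dots,g_n)\to(g_2,g_3,\dots,g_n,g_1h),\qquad g_i\in B,\ h\in K.$$ *)

theory Defs
  imports "HOL-Algebra.Algebra" "Graph_Theory.Digraph_Isomorphism"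
begin

section \<open>Configurations and wreath products\<close>

text \<open>
  Groups are \<open>HOL-Algebra\<close> records, hence written multiplicatively: the additively written
  sum $x - a$ in $A$ is \<open>x \<otimes>\<^bsub>A\<^esub> inv\<^bsub>A\<^esub> a\<close>. Configurations are extensional functions on
  \<open>carrier A\<close>. No finite support condition is imposed, so \<open>wreath\<close> is the wreath product
  with all of $\mathrm{fun}(A,B)$ as its base; for finite $A$ the two versions coincide.
\<close>

abbreviation configs ::"('a, 'c) monoid_scheme \<Rightarrow> ('b, 'd) monoid_scheme \<Rightarrow> ('a \<Rightarrow> 'b) monoid"
  where "configs A B \<equiv> product_group (carrier A) (\<lambda>_. B)"

definition shift :: "('a, 'c) monoid_scheme \<Rightarrow> 'a \<Rightarrow> ('a \<Rightarrow> 'b) \<Rightarrow> 'a \<Rightarrow> 'b"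
  where "shift A a \<Phi> = (\<lambda>x\<in>carrier A. \<Phi> (x \<otimes>\<^bsub>A\<^esub> inv\<^bsub>A\<^esub> a))"

definition delta :: "('a, 'c) monoid_scheme \<Rightarrow> ('b, 'd) monoid_scheme \<Rightarrow> 'a \<Rightarrow> 'b \<Rightarrow> 'a \<Rightarrow> 'b"
  where "delta A B a b = (\<lambda>x\<in>carrier A. if x = a then b else \<one>\<^bsub>B\<^esub>)"

definition wreath ::
    "('a, 'c) monoid_scheme \<Rightarrow> ('b, 'd) monoid_scheme \<Rightarrow> ('a \<times> ('a \<Rightarrow> 'b)) monoid"
  where "wreath A B =
    \<lparr>carrier = carrier A \<times> carrier (configs A B),
     monoid.mult = (\<lambda>(a1, \<Phi>1) (a2, \<Phi>2). (a1 \<otimes>\<^bsub>A\<^esub> a2, \<Phi>1 \<otimes>\<^bsub>configs A B\<^esub> shift A a1 \<Phi>2)),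
     one = (\<one>\<^bsub>A\<^esub>, \<one>\<^bsub>configs A B\<^esub>)\<rparr>"

definition wreath_top ::
    "('a, 'c) monoid_scheme \<Rightarrow> ('b, 'd) monoid_scheme \<Rightarrow> ('a \<times> ('a \<Rightarrow> 'b)) set"
  where "wreath_top A B = carrier A \<times> {\<one>\<^bsub>configs A B\<^esub>}"

section \<open>The homogeneous space and its identifications\<close>

text \<open>
  \<open>coset_config\<close> is the map induced on cosets by $(a,\Phi)\mapsto\mathbf T^{-a}\Phi$; this map is
  constant on each coset, so the image in the definition is a singleton.
\<close>

definition coset_config ::
    "('a, 'c) monoid_scheme \<Rightarrow> ('a \<times> ('a \<Rightarrow> 'b)) set \<Rightarrow> 'a \<Rightarrow> 'b"
  where "coset_config A C = the_elem ((\<lambda>(a, \<Phi>). shift A (inv\<^bsub>A\<^esub> a) \<Phi>) ` C)"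

definition config_action :: "('a, 'c) monoid_scheme \<Rightarrow> ('b, 'd) monoid_scheme \<Rightarrow>
    ('a \<Rightarrow> 'b) \<Rightarrow> 'a \<times> ('a \<Rightarrow> 'b) \<Rightarrow> 'a \<Rightarrow> 'b"
  where "config_action A B \<beta> = (\<lambda>(a, \<Phi>). shift A (inv\<^bsub>A\<^esub> a) (\<beta> \<otimes>\<^bsub>configs A B\<^esub> \<Phi>))"

definition words :: "('b, 'd) monoid_scheme \<Rightarrow> nat \<Rightarrow> 'b list set"
  where "words B n = {w. length w = n \<and> set w \<subseteq> carrier B}"

text \<open>
  With \<open>t\<close> the distinguished generator of \<open>A\<close>, the residue $i \bmod n$ is \<open>t [^]\<^bsub>A\<^esub> i\<close>; the
  letters of a word are indexed by $1,\dots,n$, so $0$ gives the last one.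
\<close>

definition config_word :: "('a, 'c) monoid_scheme \<Rightarrow> 'a \<Rightarrow> ('a \<Rightarrow> 'b) \<Rightarrow> 'b list"
  where "config_word A t \<Psi> = map (\<lambda>i. \<Psi> (t [^]\<^bsub>A\<^esub> i)) [1..<Suc (order A)]"

section \<open>Digraphs\<close>

definition right_action :: "('g, 'c) monoid_scheme \<Rightarrow> 'x set \<Rightarrow> ('x \<Rightarrow> 'g \<Rightarrow> 'x) \<Rightarrow> bool"
  where "right_action G V act \<longleftrightarrow>
    (\<forall>x\<in>V. \<forall>g\<in>carrier G. act x g \<in> V) \<and>
    (\<forall>x\<in>V. act x \<one>\<^bsub>G\<^esub> = x) \<and>
    (\<forall>x\<in>V. \<forall>g\<in>carrier G. \<forall>h\<in>carrier G. act x (g \<otimes>\<^bsub>G\<^esub> h) = act (act x g) h)"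

text \<open>
  Both digraphs have one arc for each pair of a vertex and a label, so that different labels
  give different (possibly parallel) arcs.
\<close>

definition schreier_digraph :: "'x set \<Rightarrow> ('x \<Rightarrow> 'g \<Rightarrow> 'x) \<Rightarrow> 'g set \<Rightarrow> ('x, 'x \<times> 'g) pre_digraph"
  where "schreier_digraph V act S =
    \<lparr>verts = V, arcs = V \<times> S, tail = fst, head = (\<lambda>(x, s). act x s)\<rparr>"

text \<open>Meaningful for \<open>n \<ge> 1\<close> only, because of \<open>hd\<close>.\<close>

definition cayley_slider_digraph ::
    "('b, 'd) monoid_scheme \<Rightarrow> 'b set \<Rightarrow> nat \<Rightarrow> ('b list, 'b list \<times> 'b) pre_digraph"
  where "cayley_slider_digraph B K n =
    \<lparr>verts = words B n, arcs = words B n \<times> K, tail = fst,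
     head = (\<lambda>(g, h). tl g @ [hd g \<otimes>\<^bsub>B\<^esub> h])\<rparr>"

section \<open>Well-formedness of the wreath product and its coset space\<close>

lemma shift_closed:
  assumes "comm_group A" "a \<in> carrier A" "\<Phi> \<in> carrier (configs A B)"
  shows "shift A a \<Phi> \<in> carrier (configs A B)"
proof -
  interpret A: comm_group A by fact
  show ?thesis using assms(2,3) by (auto simp: shift_def PiE_iff)
qed

lemma shift_mult:
  assumes "comm_group A" "a \<in> carrier A"
  shows "shift A a (\<Phi> \<otimes>\<^bsub>configs A B\<^esub> \<Psi>) = shift A a \<Phi> \<otimes>\<^bsub>configs A B\<^esub> shift A a \<Psi>"
proof -
  interpret A: comm_group A by fact
  show ?thesis using assms(2) by (auto simp: shift_def product_group_def fun_eq_iff)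
qed

lemma shift_shift:
  assumes "comm_group A" "a \<in> carrier A" "b \<in> carrier A"
  shows "shift A a (shift A b \<Phi>) = shift A (a \<otimes>\<^bsub>A\<^esub> b) \<Phi>"
proof -
  interpret A: comm_group A by fact
  show ?thesis using assms(2,3)
    by (auto simp: shift_def fun_eq_iff A.inv_mult_group A.m_assoc A.m_ac)
qed

lemma shift_one:
  assumes "comm_group A" "\<Phi> \<in> carrier (configs A B)"
  shows "shift A \<one>\<^bsub>A\<^esub> \<Phi> = \<Phi>"
proof -
  interpret A: comm_group A by fact
  show ?thesis using assms(2) by (auto simp: shift_def fun_eq_iff PiE_iff extensional_def)
qed

lemma shift_const:
  assumes "comm_group A" "a \<in> carrier A"
  shows "shift A a \<one>\<^bsub>configs A B\<^esub> = \<one>\<^bsub>configs A B\<^esub>"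
proof -
  interpret A: comm_group A by fact
  show ?thesis using assms(2) by (auto simp: shift_def fun_eq_iff)
qed

lemma group_wreath:
  assumes A: "comm_group A" and B: "group B"
  shows "group (wreath A B)"
proof -
  interpret A: comm_group A by fact
  interpret F: group "configs A B" using B by simp
  note F_simps = shift_closed[OF A] shift_mult[OF A] shift_shift[OF A] shift_one[OF A]
    shift_const[OF A] F.m_closed F.m_assoc F.one_closed
  show ?thesis
  proof (rule groupI)
    fix x assume "x \<in> carrier (wreath A B)"
    then obtain a \<Phi> where x: "x = (a, \<Phi>)" "a \<in> carrier A" "\<Phi> \<in> carrier (configs A B)"
      by (auto simp: wreath_def)
    let ?y = "(inv\<^bsub>A\<^esub> a, shift A (inv\<^bsub>A\<^esub> a) (inv\<^bsub>configs A B\<^esub> \<Phi>))"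
    have "?y \<in> carrier (wreath A B)"
      using x shift_closed[OF A, of "inv\<^bsub>A\<^esub> a" "inv\<^bsub>configs A B\<^esub> \<Phi>" B] F.inv_closed[of \<Phi>]
      by (simp add: wreath_def del: inv_product_group carrier_product_group)
    moreover have "?y \<otimes>\<^bsub>wreath A B\<^esub> x = \<one>\<^bsub>wreath A B\<^esub>"
      using x shift_mult[OF A, of "inv\<^bsub>A\<^esub> a" B "inv\<^bsub>configs A B\<^esub> \<Phi>" \<Phi>, symmetric]
        shift_const[OF A, of "inv\<^bsub>A\<^esub> a" B]
      by (simp add: wreath_def F.l_inv
            del: inv_product_group carrier_product_group mult_product_group one_product_group)
    ultimately show "\<exists>y\<in>carrier (wreath A B). y \<otimes>\<^bsub>wreath A B\<^esub> x = \<one>\<^bsub>wreath A B\<^esub>" ..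
  qed (auto simp: wreath_def F_simps A.m_assoc
        simp del: carrier_product_group mult_product_group one_product_group)
qed

lemma subgroup_wreath_top:
  assumes A: "comm_group A" and B: "group B"
  shows "subgroup (wreath_top A B) (wreath A B)"
proof -
  interpret A: comm_group A by fact
  interpret F: group "configs A B" using B by simp
  interpret G: group "wreath A B" using A B by (rule group_wreath)
  have inv: "inv\<^bsub>wreath A B\<^esub> (a, \<one>\<^bsub>configs A B\<^esub>) = (inv\<^bsub>A\<^esub> a, \<one>\<^bsub>configs A B\<^esub>)"
    if "a \<in> carrier A" for a
    using that
    by (intro G.inv_equality)
       (simp_all add: wreath_def shift_const[OF A] F.one_closed
         del: carrier_product_group mult_product_group one_product_group)
  have wreath_top_carrier: "(a, \<one>\<^bsub>configs A B\<^esub>) \<in> carrier (wreath A B)" if "a \<in> carrier A" for a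
    using that F.one_closed by (simp add: wreath_def)
  have wreath_top_mult:
    "(a, \<one>\<^bsub>configs A B\<^esub>) \<otimes>\<^bsub>wreath A B\<^esub> (b, \<one>\<^bsub>configs A B\<^esub>) = (a \<otimes>\<^bsub>A\<^esub> b, \<one>\<^bsub>configs A B\<^esub>)"
    if "a \<in> carrier A" for a b
    using that
    by (simp add: wreath_def shift_const[OF A] F.one_closed
         del: carrier_product_group mult_product_group one_product_group)
  show ?thesis
    by (rule G.subgroupI)
       (auto simp: wreath_top_def inv wreath_top_mult wreath_top_carrier
         simp del: carrier_product_group mult_product_group one_product_group
         intro: A.one_closed)
qed

lemma (in group) right_action_rcosets:
  assumes "subgroup H G"
  shows "right_action G (rcosets H) (r_coset G)"
  using subgroup.subset[OF assms]
  by (simp add: right_action_def RCOSETS_def) (auto simp: coset_mult_assoc m_assoc)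

end

theory Submission
  imports Defs
begin

text \<open>
  The coset $A(a,\Phi)$ consists of the elements $(c+a,\mathbf T^{c}\Phi)$, $c\in A$. Undoing the
  shift by the first component sends all of them to $\mathbf T^{-a}\Phi$, and
  $(0,\mathbf T^{-a}\Phi)$ is the unique element of the coset whose first component is $0$. Cosets
  and configurations therefore determine each other, and multiplying this representative
  $(0,\beta)$ by $(a,\Phi)$ gives $(a,\beta\Phi)$, whose configuration is
  $\mathbf T^{-a}(\beta\Phi)$. This is \<open>coset_config_equivariant\<close>; it makes the formula in the
  claim the natural action transported along a bijection, so that the action laws and the isomorphism
  between the two Schreier digraphs need no computation.

  What is left is one step along an arrow, in \<open>config_word_step\<close>. Acting by $(1,\delta_1^b)$
  multiplies the value at $1$ by $b$ and then moves the value at $i+1$ to $i$. In the word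
  $\beta_1\dots\beta_n$, indexed by representatives $1,\dots,n$ of the residues, the letters
  $\beta_2,\dots,\beta_n$ move one place to the left, while $\beta_1b$, the value at
  $n+1\equiv 1$, appears in the last place: this is the arrow of the slider digraph labelled by
  $b$. Since $\delta_1^b$ determines $b$, arrows correspond bijectively as well.
\<close>

section \<open>Transport along bijections\<close>

lemma digraph_isoI:
  assumes "wf_digraph G"
    and "bij_betw f (verts G) (verts H)" and "bij_betw g (arcs G) (arcs H)"
    and "\<And>e. e \<in> arcs G \<Longrightarrow> f (tail G e) = tail H (g e)"
    and "\<And>e. e \<in> arcs G \<Longrightarrow> f (head G e) = head H (g e)"
  shows "digraph_iso G H"
  unfolding digraph_iso_def
proof (intro exI conjI)
  let ?f = "\<lparr>iso_verts = f, iso_arcs = g, iso_head = head H, iso_tail = tail H\<rparr>"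
  show "pre_digraph.digraph_isomorphism G ?f"
    using assms by (simp add: pre_digraph.digraph_isomorphism_def bij_betw_def)
  show "H = app_iso ?f G"
    using assms by (simp add: app_iso_def bij_betw_def)
qed

lemma wf_schreier_digraph:
  assumes "right_action G V act" "S \<subseteq> carrier G"
  shows "wf_digraph (schreier_digraph V act S)"
  using assms by unfold_locales (auto simp: schreier_digraph_def right_action_def)

lemma digraph_iso_schreier_equivariant:
  assumes "right_action G V act" "S \<subseteq> carrier G" "bij_betw f V W"
    and "\<And>x g. x \<in> V \<Longrightarrow> g \<in> carrier G \<Longrightarrow> f (act x g) = act' (f x) g"
  shows "digraph_iso (schreier_digraph V act S) (schreier_digraph W act' S)"
proof (rule digraph_isoI[where f = f and g = "map_prod f id"])
  show "bij_betw (map_prod f id) (arcs (schreier_digraph V act S))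
      (arcs (schreier_digraph W act' S))"
    unfolding schreier_digraph_def
    using bij_betw_map_prod[OF assms(3) bij_betw_id[of S]] by simp
qed (use assms wf_schreier_digraph[OF assms(1,2)] in \<open>auto simp: schreier_digraph_def\<close>)

lemma (in monoid) right_action_transport:
  assumes act: "right_action G V act" and f: "bij_betw f V W"
    and equivariant: "\<And>x g. x \<in> V \<Longrightarrow> g \<in> carrier G \<Longrightarrow> f (act x g) = act' (f x) g"
  shows "right_action G W act'"
proof -
  have W: "W = f ` V"
    using f by (simp add: bij_betw_def)
  show ?thesis
    using act unfolding W right_action_def by (auto simp flip: equivariant)
qed

section \<open>Configurations as words\<close>

lemma (in group) comm_group_if_generated_by_one:
  assumes "t \<in> carrier G" "carrier G = generate G {t}"
  shows "comm_group G"
proof (rule cyclic_imp_abelian_group)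
  show "cyclic_group G"
    using assms generate_pow[of t] by (auto simp: cyclic_group)
qed

lemma (in group) bij_betw_generator_powers:
  assumes fin: "finite (carrier G)" and t: "t \<in> carrier G"
    and gen: "carrier G = generate G {t}"
  shows "bij_betw (\<lambda>i::nat. t [^] i) {1..order G} (carrier G)"
proof -
  have ord: "ord t = order G"
    using generate_pow_card[OF t] gen by (simp add: order_def)
  have inj: "inj_on (\<lambda>i::nat. t [^] i) {1..order G}"
    using ord_inj'[OF t] by (simp add: ord)
  have "(\<lambda>i::nat. t [^] i) ` {1..order G} = carrier G"
  proof (rule card_subset_eq[OF fin])
    show "(\<lambda>i::nat. t [^] i) ` {1..order G} \<subseteq> carrier G"
      using t by auto
    show "card ((\<lambda>i::nat. t [^] i) ` {1..order G}) = card (carrier G)"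
      using card_image[OF inj] by (simp add: order_def)
  qed
  with inj show ?thesis
    by (simp add: bij_betw_def)
qed

lemma bij_betw_config_word:
  assumes A: "group A" and fin: "finite (carrier A)" and t: "t \<in> carrier A"
    and gen: "carrier A = generate A {t}"
  shows "bij_betw (config_word A t) (carrier (configs A B)) (words B (order A))"
proof (rule bij_betw_imageI)
  interpret A: group A by fact
  let ?p = "\<lambda>i::nat. t [^]\<^bsub>A\<^esub> i"
  have p: "bij_betw ?p {1..order A} (carrier A)"
    using fin t gen by (rule A.bij_betw_generator_powers)
  show "inj_on (config_word A t) (carrier (configs A B))"
  proof (rule inj_onI)
    fix \<Phi> \<Psi>
    assume \<Phi>: "\<Phi> \<in> carrier (configs A B)" and \<Psi>: "\<Psi> \<in> carrier (configs A B)"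
      and eq: "config_word A t \<Phi> = config_word A t \<Psi>"
    have "\<Phi> x = \<Psi> x" if x: "x \<in> carrier A" for x
    proof -
      obtain i where "i \<in> {1..order A}" "x = ?p i"
        using x bij_betw_imp_surj_on[OF p] by blast
      with eq show ?thesis
        by (auto simp: config_word_def simp del: upt_Suc)
    qed
    with \<Phi> \<Psi> show "\<Phi> = \<Psi>"
      by (auto intro: PiE_ext)
  qed
  show "config_word A t ` carrier (configs A B) = words B (order A)"
  proof (intro subset_antisym subsetI)
    fix w assume w: "w \<in> words B (order A)"
    define \<Psi> where "\<Psi> = (\<lambda>x\<in>carrier A. w ! (the_inv_into {1..order A} ?p x - 1))"
    have at_power: "\<Psi> (?p i) = w ! (i - 1)" if "i \<in> {1..order A}" for i
      using that p t by (simp add: \<Psi>_def bij_betw_def the_inv_into_f_f)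
    have "\<Psi> x \<in> carrier B" if x: "x \<in> carrier A" for x
    proof -
      obtain i where i: "i \<in> {1..order A}" "x = ?p i"
        using x bij_betw_imp_surj_on[OF p] by blast
      then have "w ! (i - 1) \<in> set w"
        using w by (intro nth_mem) (auto simp: words_def)
      with i w show ?thesis
        by (auto simp: at_power words_def)
    qed
    then have "\<Psi> \<in> carrier (configs A B)"
      by (auto simp: \<Psi>_def)
    moreover have "config_word A t \<Psi> = w"
    proof (rule nth_equalityI)
      show "length (config_word A t \<Psi>) = length w"
        using w by (simp add: config_word_def words_def)
      fix i assume i: "i < length (config_word A t \<Psi>)"
      then have "config_word A t \<Psi> ! i = \<Psi> (?p (Suc i))"
        by (simp add: config_word_def del: upt_Suc)
      with i at_power[of "Suc i"] show "config_word A t \<Psi> ! i = w ! i"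
        by (simp add: config_word_def del: upt_Suc)
    qed
    ultimately show "w \<in> config_word A t ` carrier (configs A B)"
      by blast
  qed (use t in \<open>auto simp: config_word_def words_def PiE_iff\<close>)
qed

section \<open>Cosets as configurations\<close>

lemma rcoset_wreath_top:
  assumes A: "comm_group A" and B: "group B"
    and \<Phi>: "\<Phi> \<in> carrier (configs A B)"
  shows "wreath_top A B #>\<^bsub>wreath A B\<^esub> (a, \<Phi>) = (\<lambda>c. (c \<otimes>\<^bsub>A\<^esub> a, shift A c \<Phi>)) ` carrier A"
proof -
  interpret F: group "configs A B" using B by simp
  have "(c, \<one>\<^bsub>configs A B\<^esub>) \<otimes>\<^bsub>wreath A B\<^esub> (a, \<Phi>) = (c \<otimes>\<^bsub>A\<^esub> a, shift A c \<Phi>)"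
    if "c \<in> carrier A" for c
    using F.l_one[OF shift_closed[OF A that \<Phi>]] by (simp add: wreath_def)
  then show ?thesis
    by (force simp: r_coset_def wreath_top_def)
qed

text \<open>
  The shift by $-(c+a)$ cancels the shift by $c$, so all elements of the coset give the same
  configuration.
\<close>

lemma coset_config_rcoset:
  assumes A: "comm_group A" and B: "group B"
    and a: "a \<in> carrier A" and \<Phi>: "\<Phi> \<in> carrier (configs A B)"
  shows "coset_config A (wreath_top A B #>\<^bsub>wreath A B\<^esub> (a, \<Phi>)) = shift A (inv\<^bsub>A\<^esub> a) \<Phi>"
proof -
  interpret A: comm_group A by fact
  have "shift A (inv\<^bsub>A\<^esub> (c \<otimes>\<^bsub>A\<^esub> a)) (shift A c \<Phi>) = shift A (inv\<^bsub>A\<^esub> a) \<Phi>"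
    if c: "c \<in> carrier A" for c
  proof -
    have "inv\<^bsub>A\<^esub> (c \<otimes>\<^bsub>A\<^esub> a) \<otimes>\<^bsub>A\<^esub> c = inv\<^bsub>A\<^esub> a"
      using a c by (simp add: A.inv_mult_group A.m_assoc)
    with a c show ?thesis
      by (simp add: shift_shift[OF A])
  qed
  then have "(\<lambda>(a, \<Phi>). shift A (inv\<^bsub>A\<^esub> a) \<Phi>) ` (wreath_top A B #>\<^bsub>wreath A B\<^esub> (a, \<Phi>))
      = {shift A (inv\<^bsub>A\<^esub> a) \<Phi>}"
    using A.one_closed by (force simp: rcoset_wreath_top[OF A B \<Phi>] image_image)
  then show ?thesis
    by (simp add: coset_config_def)
qed

lemma coset_config_rcoset_one:
  assumes A: "comm_group A" and B: "group B" and \<Psi>: "\<Psi> \<in> carrier (configs A B)"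
  shows "coset_config A (wreath_top A B #>\<^bsub>wreath A B\<^esub> (\<one>\<^bsub>A\<^esub>, \<Psi>)) = \<Psi>"
proof -
  interpret A: comm_group A by fact
  show ?thesis
    by (simp add: coset_config_rcoset[OF A B A.one_closed \<Psi>] shift_one[OF A \<Psi>])
qed

text \<open>
  The product $(-a,\varnothing)(a,\Phi)=(0,\mathbf T^{-a}\Phi)$ lies in the coset of $(a,\Phi)$, so
  $\Psi=\mathbf T^{-a}\Phi$ works. This normal form gives the inverse of the identification of
  cosets with configurations.
\<close>

lemma rcoset_representative:
  assumes A: "comm_group A" and B: "group B"
    and C: "C \<in> rcosets\<^bsub>wreath A B\<^esub> (wreath_top A B)"
  obtains \<Psi> where "\<Psi> \<in> carrier (configs A B)" "coset_config A C = \<Psi>"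
    "C = wreath_top A B #>\<^bsub>wreath A B\<^esub> (\<one>\<^bsub>A\<^esub>, \<Psi>)"
proof -
  interpret A: comm_group A by fact
  interpret G: group "wreath A B" using A B by (rule group_wreath)
  obtain a \<Phi> where a: "a \<in> carrier A" and \<Phi>: "\<Phi> \<in> carrier (configs A B)"
    and C_eq: "C = wreath_top A B #>\<^bsub>wreath A B\<^esub> (a, \<Phi>)"
    using C by (auto simp: RCOSETS_def wreath_def)
  let ?\<Psi> = "shift A (inv\<^bsub>A\<^esub> a) \<Phi>"
  have \<Psi>: "?\<Psi> \<in> carrier (configs A B)"
    using A a \<Phi> by (intro shift_closed) auto
  have "(\<one>\<^bsub>A\<^esub>, ?\<Psi>) \<in> C"
    unfolding C_eq rcoset_wreath_top[OF A B \<Phi>]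
    using a by (intro image_eqI[where x = "inv\<^bsub>A\<^esub> a"]) auto
  moreover have "(a, \<Phi>) \<in> carrier (wreath A B)"
    using a \<Phi> by (simp add: wreath_def)
  ultimately have "C = wreath_top A B #>\<^bsub>wreath A B\<^esub> (\<one>\<^bsub>A\<^esub>, ?\<Psi>)"
    using G.repr_independence[OF _ _ subgroup_wreath_top[OF A B]] C_eq by simp
  then show thesis
    using that \<Psi> coset_config_rcoset_one[OF A B \<Psi>] by simp
qed

lemma bij_betw_coset_config:
  assumes A: "comm_group A" and B: "group B"
  shows "bij_betw (coset_config A) (rcosets\<^bsub>wreath A B\<^esub> (wreath_top A B)) (carrier (configs A B))"
proof (rule bij_betw_byWitness[where f' = "\<lambda>\<Psi>. wreath_top A B #>\<^bsub>wreath A B\<^esub> (\<one>\<^bsub>A\<^esub>, \<Psi>)"])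
  interpret A: comm_group A by fact
  show "\<forall>C\<in>rcosets\<^bsub>wreath A B\<^esub> (wreath_top A B).
      wreath_top A B #>\<^bsub>wreath A B\<^esub> (\<one>\<^bsub>A\<^esub>, coset_config A C) = C"
    by (auto elim: rcoset_representative[OF A B])
  show "\<forall>\<Psi>\<in>carrier (configs A B).
      coset_config A (wreath_top A B #>\<^bsub>wreath A B\<^esub> (\<one>\<^bsub>A\<^esub>, \<Psi>)) = \<Psi>"
    using coset_config_rcoset_one[OF A B] by blast
  show "coset_config A ` (rcosets\<^bsub>wreath A B\<^esub> (wreath_top A B)) \<subseteq> carrier (configs A B)"
    by (blast elim: rcoset_representative[OF A B])
  show "(\<lambda>\<Psi>. wreath_top A B #>\<^bsub>wreath A B\<^esub> (\<one>\<^bsub>A\<^esub>, \<Psi>)) ` carrier (configs A B)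
      \<subseteq> rcosets\<^bsub>wreath A B\<^esub> (wreath_top A B)"
    by (auto simp: RCOSETS_def wreath_def)
qed

text \<open>
  On the representative $(0,\beta)$ the product is $(0,\beta)(a,\Phi)=(a,\beta\Phi)$, without any
  shift of $\Phi$. The only shift in the action is the $\mathbf T^{-a}$ that turns the product
  back into a configuration.
\<close>

lemma coset_config_equivariant:
  assumes A: "comm_group A" and B: "group B"
    and C: "C \<in> rcosets\<^bsub>wreath A B\<^esub> (wreath_top A B)" and g: "g \<in> carrier (wreath A B)"
  shows "coset_config A (C #>\<^bsub>wreath A B\<^esub> g) = config_action A B (coset_config A C) g"
proof -
  interpret A: comm_group A by fact
  interpret F: group "configs A B" using B by simp
  interpret G: group "wreath A B" using A B by (rule group_wreath)
  obtain a \<Phi> where g_eq: "g = (a, \<Phi>)" and a: "a \<in> carrier A"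
    and \<Phi>: "\<Phi> \<in> carrier (configs A B)"
    using g by (auto simp: wreath_def)
  obtain \<beta> where \<beta>: "\<beta> \<in> carrier (configs A B)" "coset_config A C = \<beta>"
    and C_eq: "C = wreath_top A B #>\<^bsub>wreath A B\<^esub> (\<one>\<^bsub>A\<^esub>, \<beta>)"
    using rcoset_representative[OF A B C] by blast
  have "(\<one>\<^bsub>A\<^esub>, \<beta>) \<in> carrier (wreath A B)"
    using \<beta> by (simp add: wreath_def)
  then have "C #>\<^bsub>wreath A B\<^esub> g = wreath_top A B #>\<^bsub>wreath A B\<^esub> ((\<one>\<^bsub>A\<^esub>, \<beta>) \<otimes>\<^bsub>wreath A B\<^esub> g)"
    unfolding C_eq using g subgroup.subset[OF subgroup_wreath_top[OF A B]]
    by (intro G.coset_mult_assoc)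
  also have "(\<one>\<^bsub>A\<^esub>, \<beta>) \<otimes>\<^bsub>wreath A B\<^esub> g = (a, \<beta> \<otimes>\<^bsub>configs A B\<^esub> \<Phi>)"
    using a shift_one[OF A \<Phi>] by (simp add: g_eq wreath_def)
  also have "coset_config A (wreath_top A B #>\<^bsub>wreath A B\<^esub> (a, \<beta> \<otimes>\<^bsub>configs A B\<^esub> \<Phi>))
      = shift A (inv\<^bsub>A\<^esub> a) (\<beta> \<otimes>\<^bsub>configs A B\<^esub> \<Phi>)"
    using a F.m_closed[OF \<beta>(1) \<Phi>] by (rule coset_config_rcoset[OF A B])
  finally show ?thesis
    unfolding \<beta>(2) by (simp only: config_action_def g_eq prod.case)
qed

lemma right_action_config_action:
  assumes A: "comm_group A" and B: "group B"
  shows "right_action (wreath A B) (carrier (configs A B)) (config_action A B)"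
proof -
  interpret G: group "wreath A B" using A B by (rule group_wreath)
  show ?thesis
    using G.right_action_rcosets[OF subgroup_wreath_top[OF A B]] bij_betw_coset_config[OF A B]
      coset_config_equivariant[OF A B]
    by (rule G.right_action_transport)
qed

section \<open>The slider arrows\<close>

lemma delta_in_configs:
  assumes "group B" "b \<in> carrier B"
  shows "delta A B a b \<in> carrier (configs A B)"
  using assms by (auto simp: delta_def group.is_monoid)

lemma slider_generators_subset:
  assumes "t \<in> carrier A" "group B" "K \<subseteq> carrier B"
  shows "{(t, delta A B t b) | b. b \<in> K} \<subseteq> carrier (wreath A B)"
proof clarify
  fix b assume "b \<in> K"
  then have "delta A B t b \<in> carrier (configs A B)"
    using assms by (intro delta_in_configs) auto
  with assms(1) show "(t, delta A B t b) \<in> carrier (wreath A B)"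
    by (simp add: wreath_def)
qed

lemma config_action_apply:
  assumes A: "comm_group A" and a: "a \<in> carrier A" and x: "x \<in> carrier A"
  shows "config_action A B \<beta> (a, \<Phi>) x = \<beta> (x \<otimes>\<^bsub>A\<^esub> a) \<otimes>\<^bsub>B\<^esub> \<Phi> (x \<otimes>\<^bsub>A\<^esub> a)"
proof -
  interpret A: comm_group A by fact
  show ?thesis
    using a x by (simp add: config_action_def shift_def)
qed

text \<open>
  The letter at $i$ of the new word is the value at $i+1$ of $\beta\cdot\delta_1^b$. For $i<n$
  the point $i+1$ differs from $1$, so this is $\beta_{i+1}$; for $i=n$ it is the point $1$, and
  the value is $\beta_1b$.
\<close>

lemma config_word_step:
  assumes A: "group A" and fin: "finite (carrier A)" and t: "t \<in> carrier A"
    and gen: "carrier A = generate A {t}" and B: "group B"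
    and \<beta>: "\<beta> \<in> carrier (configs A B)"
  shows "config_word A t (config_action A B \<beta> (t, delta A B t b))
    = tl (config_word A t \<beta>) @ [hd (config_word A t \<beta>) \<otimes>\<^bsub>B\<^esub> b]"
proof -
  interpret A: group A by fact
  interpret B: group B by fact
  have A_comm: "comm_group A"
    using t gen by (rule A.comm_group_if_generated_by_one)
  let ?p = "\<lambda>i::nat. t [^]\<^bsub>A\<^esub> i"
  let ?\<beta>' = "config_action A B \<beta> (t, delta A B t b)"
  have inj: "inj_on ?p {1..order A}"
    using A.bij_betw_generator_powers[OF fin t gen] by (rule bij_betw_imp_inj_on)
  obtain m where m: "order A = Suc m"
    using fin A.order_gt_0_iff_finite gr0_implies_Suc by blast
  have shifted: "?\<beta>' (?p i) = \<beta> (?p (Suc i)) \<otimes>\<^bsub>B\<^esub> (if ?p (Suc i) = t then b else \<one>\<^bsub>B\<^esub>)" for i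
  proof -
    have "?\<beta>' (?p i) = \<beta> (?p i \<otimes>\<^bsub>A\<^esub> t) \<otimes>\<^bsub>B\<^esub> delta A B t b (?p i \<otimes>\<^bsub>A\<^esub> t)"
      using t by (intro config_action_apply[OF A_comm]) auto
    moreover have "?p (Suc i) \<in> carrier A"
      using t by blast
    ultimately show ?thesis
      by (simp add: delta_def)
  qed
  have inner: "?\<beta>' (?p i) = \<beta> (?p (Suc i))" if i: "i \<in> {1..<order A}" for i
  proof -
    have "?p (Suc i) \<noteq> ?p 1"
      using inj_onD[OF inj, of "Suc i" 1] i by auto
    moreover have "\<beta> (?p (Suc i)) \<in> carrier B"
      using \<beta> A.nat_pow_closed[OF t, of "Suc i"] by (auto simp: PiE_iff)
    ultimately show ?thesis
      using shifted[of i] t by simp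
  qed
  have last: "?\<beta>' (?p (order A)) = \<beta> t \<otimes>\<^bsub>B\<^esub> b"
    using shifted[of "order A"] t by (simp add: A.pow_order_eq_1)
  have "config_word A t ?\<beta>'
      = map (\<lambda>i. ?\<beta>' (?p i)) [1..<order A] @ [?\<beta>' (?p (order A))]"
    using m by (simp add: config_word_def)
  also have "map (\<lambda>i. ?\<beta>' (?p i)) [1..<order A] = map (\<lambda>i. \<beta> (?p (Suc i))) [1..<order A]"
    using inner by simp
  also have "\<dots> = map (\<lambda>i. \<beta> (?p i)) [2..<Suc (order A)]"
    by (simp add: map_Suc_upt[symmetric] numeral_2_eq_2 comp_def del: upt_Suc)
  finally have new: "config_word A t ?\<beta>'
      = map (\<lambda>i. \<beta> (?p i)) [2..<Suc (order A)] @ [\<beta> t \<otimes>\<^bsub>B\<^esub> b]"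
    by (simp only: last)
  have "[1..<Suc (order A)] = 1 # [2..<Suc (order A)]"
    using m by (simp add: upt_conv_Cons numeral_2_eq_2 del: upt_Suc)
  then have "config_word A t \<beta> = \<beta> t # map (\<lambda>i. \<beta> (?p i)) [2..<Suc (order A)]"
    using t by (simp add: config_word_def del: upt_Suc)
  with new show ?thesis
    by simp
qed

lemma schreier_digraph_iso_slider:
  assumes A: "group A" and fin: "finite (carrier A)" and t: "t \<in> carrier A"
    and gen: "carrier A = generate A {t}" and B: "group B" and K: "K \<subseteq> carrier B"
  shows "digraph_iso
    (schreier_digraph (carrier (configs A B)) (config_action A B) {(t, delta A B t b) | b. b \<in> K})
    (cayley_slider_digraph B K (order A))"
proof (rule digraph_isoI)
  let ?S = "{(t, delta A B t b) | b. b \<in> K}"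
  let ?G = "schreier_digraph (carrier (configs A B)) (config_action A B) ?S"
  have A_comm: "comm_group A"
    using A t gen by (rule group.comm_group_if_generated_by_one)
  have "?S \<subseteq> carrier (wreath A B)"
    using t B K by (rule slider_generators_subset)
  then show "wf_digraph ?G"
    using right_action_config_action[OF A_comm B] by (intro wf_schreier_digraph)
  have word: "bij_betw (config_word A t) (carrier (configs A B)) (words B (order A))"
    using A fin t gen by (rule bij_betw_config_word)
  then show "bij_betw (config_word A t) (verts ?G) (verts (cayley_slider_digraph B K (order A)))"
    by (simp add: schreier_digraph_def cayley_slider_digraph_def)
  have delta_at: "delta A B t b t = b" for b
    using t by (simp add: delta_def)
  have "bij_betw (\<lambda>s. snd s t) ?S K"
    by (rule bij_betw_byWitness[where f' = "\<lambda>b. (t, delta A B t b)"]) (auto simp: delta_at)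
  with word show "bij_betw (map_prod (config_word A t) (\<lambda>s. snd s t)) (arcs ?G)
      (arcs (cayley_slider_digraph B K (order A)))"
    unfolding schreier_digraph_def cayley_slider_digraph_def by (simp add: bij_betw_map_prod)
  fix e assume e: "e \<in> arcs ?G"
  then show "config_word A t (tail ?G e) = tail (cayley_slider_digraph B K (order A))
      (map_prod (config_word A t) (\<lambda>s. snd s t) e)"
    by (simp add: schreier_digraph_def cayley_slider_digraph_def)
  show "config_word A t (head ?G e) = head (cayley_slider_digraph B K (order A))
      (map_prod (config_word A t) (\<lambda>s. snd s t) e)"
    using e config_word_step[OF A fin t gen B]
    by (auto simp: schreier_digraph_def cayley_slider_digraph_def delta_at)
qed

theorem theorem7p10:
  fixes A :: "('a, 'c) monoid_scheme" and B :: "('b, 'd) monoid_scheme"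
    and t :: 'a and K :: "'b set"
  assumes "group A" and "finite (carrier A)"
    and "t \<in> carrier A" and "carrier A = generate A {t}"
    and "group B" and "K \<subseteq> carrier B"
  shows "bij_betw (coset_config A) (rcosets\<^bsub>wreath A B\<^esub> (wreath_top A B)) (carrier (configs A B))
    \<and> bij_betw (config_word A t) (carrier (configs A B)) (words B (order A))
    \<and> (\<forall>(a, \<Phi>) \<in> carrier (wreath A B).
         coset_config A (wreath_top A B #>\<^bsub>wreath A B\<^esub> (a, \<Phi>)) = shift A (inv\<^bsub>A\<^esub> a) \<Phi>)
    \<and> right_action (wreath A B) (rcosets\<^bsub>wreath A B\<^esub> (wreath_top A B)) (r_coset (wreath A B))
    \<and> right_action (wreath A B) (carrier (configs A B)) (config_action A B)
    \<and> (\<forall>C \<in> rcosets\<^bsub>wreath A B\<^esub> (wreath_top A B). \<forall>g \<in> carrier (wreath A B).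
         coset_config A (C #>\<^bsub>wreath A B\<^esub> g) = config_action A B (coset_config A C) g)
    \<and> digraph_iso
         (schreier_digraph (rcosets\<^bsub>wreath A B\<^esub> (wreath_top A B)) (r_coset (wreath A B))
           {(t, delta A B t b) | b. b \<in> K})
         (cayley_slider_digraph B K (order A))
    \<and> digraph_iso
         (schreier_digraph (carrier (configs A B)) (config_action A B)
           {(t, delta A B t b) | b. b \<in> K})
         (cayley_slider_digraph B K (order A))"
proof -
  let ?R = "rcosets\<^bsub>wreath A B\<^esub> (wreath_top A B)"
  let ?S = "{(t, delta A B t b) | b. b \<in> K}"
  have A: "comm_group A"
    using assms by (intro group.comm_group_if_generated_by_one)
  have B: "group B" by fact
  interpret G: group "wreath A B" using A B by (rule group_wreath)
  have natural: "right_action (wreath A B) ?R (r_coset (wreath A B))"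
    using subgroup_wreath_top[OF A B] by (rule G.right_action_rcosets)
  have "?S \<subseteq> carrier (wreath A B)"
    using assms by (intro slider_generators_subset)
  then have "digraph_iso (schreier_digraph ?R (r_coset (wreath A B)) ?S)
      (schreier_digraph (carrier (configs A B)) (config_action A B) ?S)"
    using natural bij_betw_coset_config[OF A B] coset_config_equivariant[OF A B]
    by (intro digraph_iso_schreier_equivariant)
  moreover have "digraph_iso (schreier_digraph (carrier (configs A B)) (config_action A B) ?S)
      (cayley_slider_digraph B K (order A))"
    using assms by (rule schreier_digraph_iso_slider)
  moreover have "\<forall>(a, \<Phi>) \<in> carrier (wreath A B).
      coset_config A (wreath_top A B #>\<^bsub>wreath A B\<^esub> (a, \<Phi>)) = shift A (inv\<^bsub>A\<^esub> a) \<Phi>"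
    using coset_config_rcoset[OF A B] by (auto simp: wreath_def)
  ultimately show ?thesis
    using bij_betw_coset_config[OF A B] bij_betw_config_word[OF assms(1-4)] natural
      right_action_config_action[OF A B] coset_config_equivariant[OF A B] digraph_iso_trans
    by blast
qed

end
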